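(* For every $n\ge 1$, the triple of statistics $(\mathrm{jump},\mathrm{des},\mathrm{lsuc})$ and the triple $(\mathrm{exc},\mathrm{drop},\mathrm{fix})$ are equidistributed over $S_n$, i.e. $$\sum_{\sigma\in S_n} x^{\mathrm{jump}(\sigma)} y^{\mathrm{des}(\sigma)} z^{\mathrm{lsuc}(\sigma)}=\sum_{\sigma\in S_n} x^{\mathrm{exc}(\sigma)} y^{\mathrm{drop}(\sigma)} z^{\mathrm{fix}(\sigma)}.$$
   Context: $S_n$ is the set of permutations $\sigma=\sigma_1\cdots\sigma_n$ of $[n]$, with the convention $\sigma_0=0$. $\mathrm{des}(\sigma)$ is the number of indices $1\le i\le n-1$ with $\sigma_i>\sigma_{i+1}$; $\mathrm{lsuc}(\sigma)$ is the number of indices $1\le i\le n$ with $\sigma_{i-1}+1=\sigma_i$ (left successions); $\mathrm{jump}(\sigma)$ is the number of indices $1\le i\le n$ with $\sigma_i\ge\sigma_{i-1}+2$. $\mathrm{exc}(\sigma)$, $\mathrm{drop}(\sigma)$, $\mathrm{fix}(\sigma)$ are the numbers of indices $1\le i\le n$ with $\sigma_i>i$, $\sigma_i<i$, $\sigma_i=i$ respectively. *)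

theory Defs
  imports Main "HOL-Combinatorics.Permutations"
begin

text \<open>
  A permutation of \<open>[n]\<close> is a function \<open>\<sigma> :: nat \<Rightarrow> nat\<close> with \<open>\<sigma> permutes {1..n}\<close>. Such a function
  is the identity outside \<open>{1..n}\<close>, so the convention \<open>\<sigma> 0 = 0\<close> holds automatically.
\<close>

definition des :: "nat \<Rightarrow> (nat \<Rightarrow> nat) \<Rightarrow> nat" where
  "des n \<sigma> = card {i \<in> {1..n - 1}. \<sigma> i > \<sigma> (i + 1)}"

definition lsuc :: "nat \<Rightarrow> (nat \<Rightarrow> nat) \<Rightarrow> nat" where
  "lsuc n \<sigma> = card {i \<in> {1..n}. \<sigma> (i - 1) + 1 = \<sigma> i}"

definition jump :: "nat \<Rightarrow> (nat \<Rightarrow> nat) \<Rightarrow> nat" where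
  "jump n \<sigma> = card {i \<in> {1..n}. \<sigma> i \<ge> \<sigma> (i - 1) + 2}"

definition exc :: "nat \<Rightarrow> (nat \<Rightarrow> nat) \<Rightarrow> nat" where
  "exc n \<sigma> = card {i \<in> {1..n}. \<sigma> i > i}"

definition drop_stat :: "nat \<Rightarrow> (nat \<Rightarrow> nat) \<Rightarrow> nat" where
  "drop_stat n \<sigma> = card {i \<in> {1..n}. \<sigma> i < i}"

definition fix_stat :: "nat \<Rightarrow> (nat \<Rightarrow> nat) \<Rightarrow> nat" where
  "fix_stat n \<sigma> = card {i \<in> {1..n}. \<sigma> i = i}"

end

theory Submission
  imports Defs
begin

text \<open>
  Both triples obey the same growth rule when the letter \<open>n + 1\<close> is inserted into a permutation of
  \<open>[n]\<close>. Inserting it into an arc \<open>j \<mapsto> \<sigma> j\<close> of the cycle diagram turns an excedance into an excedance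
  and a drop, a drop into an excedance and a drop, and a fixed point into an excedance and a drop;
  as a new cycle it adds a fixed point. Inserting it into the word
  \<open>0 \<sigma>\<^sub>1 \<dots> \<sigma>\<^sub>n\<close> turns a jump, a descent or a left succession into a jump and a descent, and adds a
  jump when appended at the end. The only exception is the gap after the letter \<open>n\<close>, which is a
  descent or the end, where a left succession is added instead. So the \<open>des \<sigma> + 1\<close> gaps that are
  descents or the end split into one that adds a left succession and \<open>des \<sigma>\<close> that add a jump.
\<close>

text \<open>For a permutation of \<open>[n]\<close> with triple \<open>(a, b, c)\<close>, this is
  the total weight \<open>f\<close> of the \<open>n + 1\<close> permutations that arise by inserting
  the letter \<open>n + 1\<close>. The truncated \<open>c - 1\<close> is harmless, since its
  coefficient vanishes at \<open>c = 0\<close>.\<close>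

definition insertion_step :: "(nat \<Rightarrow> nat \<Rightarrow> nat \<Rightarrow> 'a) \<Rightarrow> nat \<Rightarrow> nat \<Rightarrow> nat \<Rightarrow> 'a::comm_semiring_1"
  where "insertion_step f a b c =
    f a b (Suc c) + of_nat a * f a (Suc b) c + of_nat b * f (Suc a) b c
      + of_nat c * f (Suc a) (Suc b) (c - 1)"

text \<open>Serves to count only two of three classes of insertion places directly; the size
  \<open>b\<close> of the remaining class follows from the total.\<close>

lemma sum_if_if_const:
  fixes A B C :: "'a::comm_semiring_1"
  assumes "finite K" and "\<And>k. k \<in> K \<Longrightarrow> \<not> (P k \<and> Q k)"
    and "card {k \<in> K. P k} + b + card {k \<in> K. Q k} = card K"
  shows "(\<Sum>k\<in>K. if P k then A else if Q k then C else B) =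
    of_nat (card {k \<in> K. P k}) * A + of_nat b * B + of_nat (card {k \<in> K. Q k}) * C"
proof -
  let ?R = "{k \<in> K. \<not> P k \<and> \<not> Q k}"
  have K: "K = {k \<in> K. P k} \<union> ({k \<in> K. Q k} \<union> ?R)" by auto
  have "card K = card {k \<in> K. P k} + (card {k \<in> K. Q k} + card ?R)"
    using assms(1,2) by (subst K, subst card_Un_disjoint; (subst card_Un_disjoint)?) auto
  then have b: "card ?R = b" using assms(3) by simp
  let ?g = "\<lambda>k. if P k then A else if Q k then C else B"
  have "sum ?g K = sum ?g {k \<in> K. P k} + (sum ?g {k \<in> K. Q k} + sum ?g ?R)"
    using assms(1,2)
    by (subst K, subst sum.union_disjoint; (subst sum.union_disjoint)?) auto
  also have "sum ?g {k \<in> K. P k} = (\<Sum>k | k \<in> K \<and> P k. A)"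
    by (rule sum.cong) auto
  also have "sum ?g {k \<in> K. Q k} = (\<Sum>k | k \<in> K \<and> Q k. C)"
    using assms(2) by (intro sum.cong) auto
  also have "sum ?g ?R = (\<Sum>k\<in>?R. B)"
    by (rule sum.cong) auto
  finally show ?thesis by (simp only: sum_constant b add_ac)
qed

lemma card_Collect_conv_sum:
  "finite A \<Longrightarrow> card {i \<in> A. P i} = (\<Sum>i\<in>A. of_bool (P i))"
  by (simp add: Collect_conj_eq Int_commute)

subsection \<open>Insertion into a cycle\<close>

lemma exc_drop_fix_sum:
  "exc n \<sigma> + drop_stat n \<sigma> + fix_stat n \<sigma> = n"
proof -
  have "exc n \<sigma> + drop_stat n \<sigma> + fix_stat n \<sigma> =
    (\<Sum>i=1..n. of_bool (\<sigma> i > i) + of_bool (\<sigma> i < i) + of_bool (\<sigma> i = i))"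
    unfolding exc_def drop_stat_def fix_stat_def
    by (subst (1 2 3) card_Collect_conv_sum) (simp_all only: finite_atLeastAtMost sum.distrib)
  also have "\<dots> = (\<Sum>i=1..n. 1)"
    by (rule sum.cong) auto
  finally show ?thesis by simp
qed

text \<open>For \<open>j \<le> n\<close>, composing on the right with
  \<open>transpose (Suc n) j\<close> replaces the arc from \<open>j\<close> to
  \<open>\<sigma> j\<close> by arcs from \<open>j\<close> to \<open>n + 1\<close> and from
  \<open>n + 1\<close> to \<open>\<sigma> j\<close>; for \<open>j = n + 1\<close> it leaves
  \<open>\<sigma>\<close> unchanged.\<close>

lemma sum_permutes_Suc_cycle:
  fixes F :: "(nat \<Rightarrow> nat) \<Rightarrow> 'a::comm_monoid_add"
  shows "(\<Sum>\<tau> | \<tau> permutes {1..Suc n}. F \<tau>) =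
    (\<Sum>\<sigma> | \<sigma> permutes {1..n}. \<Sum>j=1..Suc n. F (\<sigma> \<circ> transpose (Suc n) j))"
proof -
  have ins: "{1..Suc n} = insert (Suc n) {1..n}" by auto
  have "(\<Sum>\<tau> | \<tau> permutes {1..Suc n}. F \<tau>) =
    (\<Sum>b\<in>{1..Suc n}. \<Sum>\<sigma> | \<sigma> permutes {1..n}. F (transpose (Suc n) b \<circ> \<sigma>))"
    unfolding ins by (rule sum_over_permutations_insert) auto
  also have "\<dots> = (\<Sum>\<sigma> | \<sigma> permutes {1..n}. \<Sum>b\<in>{1..Suc n}. F (transpose (Suc n) b \<circ> \<sigma>))"
    by (rule sum.swap)
  also have "\<dots> = (\<Sum>\<sigma> | \<sigma> permutes {1..n}. \<Sum>j=1..Suc n. F (\<sigma> \<circ> transpose (Suc n) j))"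
  proof (rule sum.cong [OF refl])
    fix \<sigma> assume "\<sigma> \<in> {\<sigma>. \<sigma> permutes {1..n}}"
    then have s: "\<sigma> permutes {1..n}" by simp
    then have s': "\<sigma> permutes {1..Suc n}" by (rule permutes_subset) auto
    have fixn: "\<sigma> (Suc n) = Suc n" using s by (simp add: permutes_not_in)
    \<comment> \<open>Conjugation by \<open>\<sigma>\<close>, which fixes \<open>n + 1\<close>,
      moves the transposition to the other side. The reindexing \<open>b = \<sigma> j\<close> of
      \<open>{1..Suc n}\<close> then turns one sum into the other.\<close>
    have "transpose (Suc n) (\<sigma> j) \<circ> \<sigma> = \<sigma> \<circ> transpose (Suc n) j" for j
      using transpose_comp_eq[OF permutes_bij[OF s], of "Suc n" "\<sigma> j"]
        permutes_inverses(2)[OF s] fixn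
      by (metis permutes_inv_eq s)
    then show "(\<Sum>b\<in>{1..Suc n}. F (transpose (Suc n) b \<circ> \<sigma>)) =
        (\<Sum>j=1..Suc n. F (\<sigma> \<circ> transpose (Suc n) j))"
      by (subst sum.permute[OF s']) (simp add: o_def)
  qed
  finally show ?thesis .
qed

text \<open>One arc is replaced by two and all others stay. The lost arc is added on the left so
  that no subtraction of naturals occurs. Taking \<open>h\<close> to be an indicator covers all
  three statistics.\<close>

lemma sum_cycle_insert:
  fixes h :: "nat \<Rightarrow> nat \<Rightarrow> nat"
  assumes "\<sigma> permutes {1..n}" and "j \<in> {1..n}"
  shows "(\<Sum>i=1..Suc n. h i ((\<sigma> \<circ> transpose (Suc n) j) i)) + h j (\<sigma> j) =
    (\<Sum>i=1..n. h i (\<sigma> i)) + h j (Suc n) + h (Suc n) (\<sigma> j)"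
proof -
  let ?\<tau> = "\<sigma> \<circ> transpose (Suc n) j"
  have fixn: "\<sigma> (Suc n) = Suc n" using assms(1) by (simp add: permutes_not_in)
  have "(\<Sum>i=1..n. h i (?\<tau> i)) = h j (Suc n) + (\<Sum>i\<in>{1..n} - {j}. h i (?\<tau> i))"
    using assms(2) by (subst sum.remove[of _ j]) (auto simp: fixn)
  also have "(\<Sum>i\<in>{1..n} - {j}. h i (?\<tau> i)) = (\<Sum>i\<in>{1..n} - {j}. h i (\<sigma> i))"
    by (rule sum.cong) (auto simp: transpose_def)
  also have "(h j (Suc n) + (\<Sum>i\<in>{1..n} - {j}. h i (\<sigma> i))) + h j (\<sigma> j) =
      h j (Suc n) + (\<Sum>i=1..n. h i (\<sigma> i))"
    using assms(2) by (subst (2) sum.remove[of _ j]) auto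
  finally show ?thesis by simp
qed

lemma card_cycle_insert:
  assumes "\<sigma> permutes {1..n}" and "j \<in> {1..n}"
  shows "card {i \<in> {1..Suc n}. P i ((\<sigma> \<circ> transpose (Suc n) j) i)} + of_bool (P j (\<sigma> j)) =
    card {i \<in> {1..n}. P i (\<sigma> i)} + of_bool (P j (Suc n)) + of_bool (P (Suc n) (\<sigma> j))"
  using sum_cycle_insert[OF assms, of "\<lambda>u v. of_bool (P u v)"]
  by (simp only: card_Collect_conv_sum finite_atLeastAtMost)

lemma sum_cycle_insertions:
  fixes f :: "nat \<Rightarrow> nat \<Rightarrow> nat \<Rightarrow> 'a::comm_semiring_1"
  assumes s: "\<sigma> permutes {1..n}"
  shows "(\<Sum>j=1..Suc n. let \<tau> = \<sigma> \<circ> transpose (Suc n) j in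
      f (exc (Suc n) \<tau>) (drop_stat (Suc n) \<tau>) (fix_stat (Suc n) \<tau>)) =
    insertion_step f (exc n \<sigma>) (drop_stat n \<sigma>) (fix_stat n \<sigma>)"
proof -
  define g where "g j = (let \<tau> = \<sigma> \<circ> transpose (Suc n) j in
      f (exc (Suc n) \<tau>) (drop_stat (Suc n) \<tau>) (fix_stat (Suc n) \<tau>))" for j
  let ?a = "exc n \<sigma>" and ?b = "drop_stat n \<sigma>" and ?c = "fix_stat n \<sigma>"
  have fixn: "\<sigma> (Suc n) = Suc n" using s by (simp add: permutes_not_in)
  have insert: "card {i \<in> {1..Suc n}. P i} = card {i \<in> {1..n}. P i} + of_bool (P (Suc n))" for P
    by (subst (1 2) card_Collect_conv_sum) simp_all
  have "exc (Suc n) \<sigma> = ?a" "drop_stat (Suc n) \<sigma> = ?b" "fix_stat (Suc n) \<sigma> = Suc ?c"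
    unfolding exc_def drop_stat_def fix_stat_def insert by (simp_all add: fixn)
  then have new: "g (Suc n) = f ?a ?b (Suc ?c)"
    by (simp add: g_def)
  have old: "g j = (if \<sigma> j > j then f ?a (Suc ?b) ?c
      else if \<sigma> j = j then f (Suc ?a) (Suc ?b) (?c - 1) else f (Suc ?a) ?b ?c)"
    if j: "j \<in> {1..n}" for j
  proof -
    let ?\<tau> = "\<sigma> \<circ> transpose (Suc n) j"
    have "\<sigma> j \<in> {1..n}" using permutes_in_image[OF s] j by blast
    then have le: "\<sigma> j < Suc n" "j < Suc n" using j by auto
    \<comment> \<open>The new arc from \<open>j\<close> to \<open>n + 1\<close> is always an
      excedance and the one from \<open>n + 1\<close> to \<open>\<sigma> j\<close> always a drop, so
      only the type of the lost arc matters.\<close>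
    have "exc (Suc n) ?\<tau> + of_bool (\<sigma> j > j) = Suc ?a"
      using card_cycle_insert[OF s j, of "\<lambda>u v. v > u"] le by (simp add: exc_def)
    moreover have "drop_stat (Suc n) ?\<tau> + of_bool (\<sigma> j < j) = Suc ?b"
      using card_cycle_insert[OF s j, of "\<lambda>u v. v < u"] le by (simp add: drop_stat_def)
    moreover have "fix_stat (Suc n) ?\<tau> = ?c - of_bool (\<sigma> j = j)"
      using card_cycle_insert[OF s j, of "\<lambda>u v. v = u"] le
      unfolding fix_stat_def by (intro add_implies_diff) simp
    ultimately show ?thesis
      by (cases "\<sigma> j" j rule: linorder_cases) (auto simp: g_def Let_def)
  qed
  have "(\<Sum>j=1..Suc n. g j) = g (Suc n) + (\<Sum>j=1..n. g j)"
    by (simp add: add.commute)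
  \<comment> \<open>Drops form the default class; their number comes from the three statistics
    adding up to \<open>n\<close>.\<close>
  also have "(\<Sum>j=1..n. g j) = of_nat ?a * f ?a (Suc ?b) ?c + of_nat ?b * f (Suc ?a) ?b ?c
      + of_nat ?c * f (Suc ?a) (Suc ?b) (?c - 1)"
    unfolding exc_def[of n] fix_stat_def[of n]
    using exc_drop_fix_sum[of n \<sigma>, unfolded exc_def fix_stat_def]
    by (subst sum_if_if_const[symmetric, where K = "{1..n}"])
      (use old in \<open>auto simp: exc_def fix_stat_def intro!: sum.cong\<close>)
  finally show ?thesis
    by (simp only: g_def[symmetric] new insertion_step_def add.assoc)
qed

lemma sum_permutes_Suc_exc_drop_fix:
  fixes f :: "nat \<Rightarrow> nat \<Rightarrow> nat \<Rightarrow> 'a::comm_semiring_1"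
  shows "(\<Sum>\<sigma> | \<sigma> permutes {1..Suc n}.
      f (exc (Suc n) \<sigma>) (drop_stat (Suc n) \<sigma>) (fix_stat (Suc n) \<sigma>)) =
    (\<Sum>\<sigma> | \<sigma> permutes {1..n}. insertion_step f (exc n \<sigma>) (drop_stat n \<sigma>) (fix_stat n \<sigma>))"
  unfolding sum_permutes_Suc_cycle
  using sum_cycle_insertions[of _ n f] by (intro sum.cong) (simp_all only: Let_def mem_Collect_eq)

subsection \<open>Insertion into a word\<close>

text \<open>The word of \<open>\<sigma> \<circ> insert_pos n k\<close> is that of \<open>\<sigma>\<close> with \<open>n + 1\<close> inserted after \<open>\<sigma>\<^sub>k\<close>.\<close>

definition insert_pos :: "nat \<Rightarrow> nat \<Rightarrow> nat \<Rightarrow> nat" where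
  "insert_pos n k i =
    (if i \<le> k \<or> i > Suc n then i else if i = Suc k then Suc n else i - 1)"

lemma insert_pos_permutes:
  assumes "k \<le> n"
  shows "insert_pos n k permutes {1..Suc n}"
proof (rule bij_imp_permutes)
  have "insert_pos n k ` {1..Suc n} \<subseteq> {1..Suc n}" "inj_on (insert_pos n k) {1..Suc n}"
    using assms by (auto simp: insert_pos_def inj_on_def)
  then show "bij_betw (insert_pos n k) {1..Suc n} {1..Suc n}"
    by (simp add: bij_betw_def endo_inj_surj)
qed (use assms in \<open>auto simp: insert_pos_def\<close>)

text \<open>The position \<open>k + 1\<close> of the letter \<open>n + 1\<close> determines
  \<open>k\<close>, and cancelling the bijection \<open>insert_pos n k\<close> then recovers
  \<open>\<sigma>\<close>. That every permutation of \<open>[n + 1]\<close> is reached follows by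
  counting, as \<open>n! * (n + 1) = (n + 1)!\<close>.\<close>

lemma sum_permutes_Suc_word:
  fixes F :: "(nat \<Rightarrow> nat) \<Rightarrow> 'a::comm_monoid_add"
  shows "(\<Sum>\<tau> | \<tau> permutes {1..Suc n}. F \<tau>) =
    (\<Sum>\<sigma> | \<sigma> permutes {1..n}. \<Sum>k\<le>n. F (\<sigma> \<circ> insert_pos n k))"
proof -
  let ?D = "{\<sigma>. \<sigma> permutes {1..n}} \<times> {..n}"
  let ?G = "\<lambda>(\<sigma>, k). \<sigma> \<circ> insert_pos n k"
  have inj: "inj_on ?G ?D"
  proof (rule inj_onI, clarsimp)
    fix \<sigma> k \<sigma>' k'
    assume s: "\<sigma> permutes {Suc 0..n}" "\<sigma>' permutes {Suc 0..n}" and k: "k \<le> n" "k' \<le> n"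
      and eq: "\<sigma> \<circ> insert_pos n k = \<sigma>' \<circ> insert_pos n k'"
    have "\<sigma> (Suc n) = Suc n" "\<sigma>' (Suc n) = Suc n"
      using s by (simp_all add: permutes_not_in)
    then have "(\<sigma> \<circ> insert_pos n k) (Suc k) = Suc n" "(\<sigma>' \<circ> insert_pos n k') (Suc k') = Suc n"
      using k by (simp_all add: insert_pos_def)
    moreover have "inj (\<sigma> \<circ> insert_pos n k)"
      using permutes_inj[OF s(1)] permutes_inj[OF insert_pos_permutes[OF k(1)]]
      by (rule inj_compose)
    ultimately have "k = k'" using eq by (metis injD Suc_inject)
    moreover have "surj (insert_pos n k)"
      using insert_pos_permutes[OF k(1)] by (rule permutes_surj)
    ultimately show "\<sigma> = \<sigma>' \<and> k = k'"
      using eq by (metis comp_apply surjD ext)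
  qed
  have "?G ` ?D = {\<tau>. \<tau> permutes {1..Suc n}}"
  proof (rule card_subset_eq)
    show "finite {\<tau>. \<tau> permutes {1..Suc n}}" by (simp add: finite_permutations)
    have "\<sigma> permutes {1..Suc n}" if "\<sigma> permutes {1..n}" for \<sigma>
      using that by (rule permutes_subset) auto
    then show "?G ` ?D \<subseteq> {\<tau>. \<tau> permutes {1..Suc n}}"
      using insert_pos_permutes by (auto intro!: permutes_compose)
    show "card (?G ` ?D) = card {\<tau>. \<tau> permutes {1..Suc n}}"
      by (subst card_image[OF inj]) (simp add: card_cartesian_product card_permutations[OF refl])
  qed
  then have "(\<Sum>\<tau> | \<tau> permutes {1..Suc n}. F \<tau>) = sum F (?G ` ?D)" by simp
  also have "\<dots> = (\<Sum>p\<in>?D. F (?G p))"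
    by (subst sum.reindex[OF inj]) (simp add: o_def)
  finally show ?thesis
    by (simp add: sum.cartesian_product case_prod_unfold)
qed

text \<open>Only the adjacent pair at the inner gap \<open>k\<close> changes: it gives way to two
  pairs through \<open>n + 1\<close>. Index 0 takes part, so the pair of
  \<open>\<sigma> 0 = 0\<close> and \<open>\<sigma> 1\<close> counts as a gap.\<close>

lemma sum_word_insert:
  fixes h :: "nat \<Rightarrow> nat \<Rightarrow> nat"
  assumes "\<sigma> permutes {1..n}" and "k < n"
  shows "(\<Sum>i<Suc n. h ((\<sigma> \<circ> insert_pos n k) i) ((\<sigma> \<circ> insert_pos n k) (Suc i))) +
      h (\<sigma> k) (\<sigma> (Suc k)) =
    (\<Sum>i<n. h (\<sigma> i) (\<sigma> (Suc i))) + h (\<sigma> k) (Suc n) + h (Suc n) (\<sigma> (Suc k))"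
proof -
  let ?\<tau> = "\<sigma> \<circ> insert_pos n k"
  have fixn: "\<sigma> (Suc n) = Suc n" using assms(1) by (simp add: permutes_not_in)
  have vals: "?\<tau> k = \<sigma> k" "?\<tau> (Suc k) = Suc n" "?\<tau> (Suc (Suc k)) = \<sigma> (Suc k)"
    using assms(2) by (auto simp: insert_pos_def fixn)
  have split: "sum g {..<n} = sum g {..<k} + g k + sum g {Suc k..<n}" for g :: "nat \<Rightarrow> nat"
    using assms(2) sum.atLeastLessThan_concat[of 0 k n g] sum.atLeast_Suc_lessThan[of k n g]
    by (simp add: atLeast0LessThan)
  \<comment> \<open>The two new pairs sit at the indices \<open>k\<close> and \<open>k + 1\<close>;
    the pairs behind them are the old ones shifted by one.\<close>
  have "sum g {..<Suc n} = sum g {..<k} + g k + g (Suc k) + sum g {Suc (Suc k)..<Suc n}"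
    for g :: "nat \<Rightarrow> nat"
    using assms(2) sum.atLeastLessThan_concat[of 0 k "Suc n" g]
      sum.atLeast_Suc_lessThan[of k "Suc n" g] sum.atLeast_Suc_lessThan[of "Suc k" "Suc n" g]
    by (simp add: atLeast0LessThan del: sum.op_ivl_Suc sum.lessThan_Suc)
  then have "(\<Sum>i<Suc n. h (?\<tau> i) (?\<tau> (Suc i))) =
      (\<Sum>i<k. h (?\<tau> i) (?\<tau> (Suc i))) + h (?\<tau> k) (?\<tau> (Suc k)) + h (?\<tau> (Suc k)) (?\<tau> (Suc (Suc k)))
      + (\<Sum>i=Suc k..<n. h (?\<tau> (Suc i)) (?\<tau> (Suc (Suc i))))"
    by (simp only: sum.shift_bounds_Suc_ivl)
  also have "(\<Sum>i<k. h (?\<tau> i) (?\<tau> (Suc i))) = (\<Sum>i<k. h (\<sigma> i) (\<sigma> (Suc i)))"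
    using assms(2) by (intro sum.cong) (auto simp: insert_pos_def)
  also have "(\<Sum>i=Suc k..<n. h (?\<tau> (Suc i)) (?\<tau> (Suc (Suc i)))) =
      (\<Sum>i=Suc k..<n. h (\<sigma> i) (\<sigma> (Suc i)))"
    by (intro sum.cong) (auto simp: insert_pos_def)
  finally have new: "(\<Sum>i<Suc n. h (?\<tau> i) (?\<tau> (Suc i))) = (\<Sum>i<k. h (\<sigma> i) (\<sigma> (Suc i)))
      + h (\<sigma> k) (Suc n) + h (Suc n) (\<sigma> (Suc k)) + (\<Sum>i=Suc k..<n. h (\<sigma> i) (\<sigma> (Suc i)))"
    unfolding vals .
  have "S + e = T + b + c" if "S = A + b + c + D" "T = A + e + D" for S T A D b c e :: nat
    using that by simp
  from this[OF new split] show ?thesis .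
qed

lemma card_word_insert:
  assumes "\<sigma> permutes {1..n}" and "k < n"
  shows "card {i \<in> {..<Suc n}. P ((\<sigma> \<circ> insert_pos n k) i) ((\<sigma> \<circ> insert_pos n k) (Suc i))} +
      of_bool (P (\<sigma> k) (\<sigma> (Suc k))) =
    card {i \<in> {..<n}. P (\<sigma> i) (\<sigma> (Suc i))} +
      of_bool (P (\<sigma> k) (Suc n)) + of_bool (P (Suc n) (\<sigma> (Suc k)))"
  using sum_word_insert[OF assms, of "\<lambda>u v. of_bool (P u v)"]
  by (simp only: card_Collect_conv_sum finite_lessThan)

text \<open>Appending destroys no adjacent pair, so there is nothing to compensate on the
  left.\<close>

lemma card_word_append:
  assumes "\<sigma> permutes {1..n}"
  shows "card {i \<in> {..<Suc n}. P ((\<sigma> \<circ> insert_pos n n) i) ((\<sigma> \<circ> insert_pos n n) (Suc i))} =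
    card {i \<in> {..<n}. P (\<sigma> i) (\<sigma> (Suc i))} + of_bool (P (\<sigma> n) (Suc n))"
proof -
  let ?\<tau> = "\<sigma> \<circ> insert_pos n n"
  have fixn: "\<sigma> (Suc n) = Suc n" using assms by (simp add: permutes_not_in)
  have "(\<Sum>i<n. of_bool (P (?\<tau> i) (?\<tau> (Suc i)))) = (\<Sum>i<n. of_bool (P (\<sigma> i) (\<sigma> (Suc i))) :: nat)"
    by (rule sum.cong) (auto simp: insert_pos_def)
  moreover have "?\<tau> n = \<sigma> n" "?\<tau> (Suc n) = Suc n"
    by (simp_all add: insert_pos_def fixn)
  ultimately show ?thesis
    by (simp only: card_Collect_conv_sum finite_lessThan sum.lessThan_Suc)
qed

lemma card_shift_interval:
  "card {i \<in> {1..n}. P (i - 1) i} = card {i \<in> {..<n}. P i (Suc i)}"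
proof -
  have "{i \<in> {1..n}. P (i - 1) i} = Suc ` {i \<in> {..<n}. P i (Suc i)}"
    by (auto simp: image_iff Suc_le_eq gr0_conv_Suc)
  then show ?thesis by (simp add: card_image)
qed

lemma lsuc_eq: "lsuc n \<sigma> = card {i \<in> {..<n}. Suc (\<sigma> i) = \<sigma> (Suc i)}"
  using card_shift_interval[of n "\<lambda>i j. \<sigma> i + 1 = \<sigma> j"] by (simp add: lsuc_def)

lemma jump_eq: "jump n \<sigma> = card {i \<in> {..<n}. \<sigma> i + 2 \<le> \<sigma> (Suc i)}"
  using card_shift_interval[of n "\<lambda>i j. \<sigma> i + 2 \<le> \<sigma> j"] by (simp add: jump_def)

lemma des_eq:
  assumes "\<sigma> permutes {1..n}"
  shows "des n \<sigma> = card {i \<in> {..<n}. \<sigma> i > \<sigma> (Suc i)}"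
proof -
  have "\<sigma> 0 = 0" using assms by (simp add: permutes_not_in)
  then have "{i \<in> {1..n - 1}. \<sigma> i > \<sigma> (i + 1)} = {i \<in> {..<n}. \<sigma> i > \<sigma> (Suc i)}"
    by (auto simp: Suc_le_eq intro: gr0I)
  then show ?thesis by (simp add: des_def)
qed

text \<open>Neighbouring letters differ by injectivity, so each of the \<open>n\<close> gaps is of
  exactly one of the three types.\<close>

lemma jump_des_lsuc_sum:
  assumes s: "\<sigma> permutes {1..n}"
  shows "jump n \<sigma> + des n \<sigma> + lsuc n \<sigma> = n"
proof -
  have "jump n \<sigma> + des n \<sigma> + lsuc n \<sigma> = (\<Sum>i<n. of_bool (\<sigma> i + 2 \<le> \<sigma> (Suc i)) +
      of_bool (\<sigma> i > \<sigma> (Suc i)) + of_bool (Suc (\<sigma> i) = \<sigma> (Suc i)))"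
    unfolding jump_eq des_eq[OF s] lsuc_eq
    by (subst (1 2 3) card_Collect_conv_sum) (simp_all only: finite_lessThan sum.distrib)
  also have "\<dots> = (\<Sum>i<n. 1)"
  proof (rule sum.cong [OF refl])
    fix i
    have "\<sigma> i \<noteq> \<sigma> (Suc i)" using permutes_inj[OF s] by (simp add: inj_eq)
    then show "of_bool (\<sigma> i + 2 \<le> \<sigma> (Suc i)) + of_bool (\<sigma> i > \<sigma> (Suc i)) +
        of_bool (Suc (\<sigma> i) = \<sigma> (Suc i)) = (1::nat)"
      by (auto simp: of_bool_def)
  qed
  finally show ?thesis by simp
qed

lemma sum_word_insertions:
  fixes f :: "nat \<Rightarrow> nat \<Rightarrow> nat \<Rightarrow> 'a::comm_semiring_1"
  assumes s: "\<sigma> permutes {1..n}"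
  shows "(\<Sum>k\<le>n. let \<tau> = \<sigma> \<circ> insert_pos n k in
      f (jump (Suc n) \<tau>) (des (Suc n) \<tau>) (lsuc (Suc n) \<tau>)) =
    insertion_step f (jump n \<sigma>) (des n \<sigma>) (lsuc n \<sigma>)"
proof -
  define g where "g k = (let \<tau> = \<sigma> \<circ> insert_pos n k in
      f (jump (Suc n) \<tau>) (des (Suc n) \<tau>) (lsuc (Suc n) \<tau>))" for k
  let ?a = "jump n \<sigma>" and ?b = "des n \<sigma>" and ?c = "lsuc n \<sigma>"
  \<comment> \<open>The position of the letter \<open>n\<close>, or 0 if \<open>n = 0\<close>: the
    gap where inserting \<open>n + 1\<close> creates a left succession.\<close>
  define m where "m = inv \<sigma> n"
  have m: "\<sigma> k = n \<longleftrightarrow> k = m" for k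
    unfolding m_def using permutes_inv_eq[OF s] by metis
  have le: "\<sigma> k \<le> n" if "k \<le> n" for k
    using that permutes_in_image[OF s, of k] permutes_not_in[OF s, of k]
    by (cases "k \<in> {1..n}") auto
  have "m \<le> n"
    using m[of m] permutes_not_in[OF s, of m] by (cases "m \<in> {1..n}") auto
  have dsuc: "des (Suc n) (\<sigma> \<circ> insert_pos n k) = card {i \<in> {..<Suc n}.
      (\<sigma> \<circ> insert_pos n k) i > (\<sigma> \<circ> insert_pos n k) (Suc i)}" if "k \<le> n" for k
    by (rule des_eq) (use insert_pos_permutes[OF that] s in
        \<open>auto intro!: permutes_compose intro: permutes_subset\<close>)
  have g: "g k = (if k = m then f ?a ?b (Suc ?c)
      else if k < n \<and> \<sigma> k + 2 \<le> \<sigma> (Suc k) then f ?a (Suc ?b) ?c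
      else if k < n \<and> Suc (\<sigma> k) = \<sigma> (Suc k) then f (Suc ?a) (Suc ?b) (?c - 1)
      else f (Suc ?a) ?b ?c)" if k: "k \<le> n" for k
  proof (cases "k < n")
    case True
    let ?\<tau> = "\<sigma> \<circ> insert_pos n k"
    have ne: "\<sigma> k \<noteq> \<sigma> (Suc k)" using permutes_inj[OF s] by (simp add: inj_eq)
    have bd: "\<sigma> k \<le> n" "\<sigma> (Suc k) \<le> n" using le True by auto
    \<comment> \<open>The new pair of \<open>\<sigma> k\<close> and \<open>n + 1\<close> is a jump
      unless \<open>\<sigma> k = n\<close>, that is, unless \<open>k = m\<close>.\<close>
    have j: "jump (Suc n) ?\<tau> + of_bool (\<sigma> k + 2 \<le> \<sigma> (Suc k)) = ?a + of_bool (k \<noteq> m)"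
      using card_word_insert[OF s True, of "\<lambda>u v. u + 2 \<le> v"] bd m[of k]
      unfolding jump_eq by (auto simp: of_bool_def split: if_splits)
    have d: "des (Suc n) ?\<tau> + of_bool (\<sigma> k > \<sigma> (Suc k)) = Suc ?b"
      using card_word_insert[OF s True, of "\<lambda>u v. u > v"] bd
      unfolding dsuc[OF k] des_eq[OF s] by simp
    have l: "lsuc (Suc n) ?\<tau> = ?c + of_bool (k = m) - of_bool (Suc (\<sigma> k) = \<sigma> (Suc k))"
      using card_word_insert[OF s True, of "\<lambda>u v. Suc u = v"] bd m[of k]
      unfolding lsuc_eq by (intro add_implies_diff) simp
    \<comment> \<open>After the largest letter \<open>n\<close> an inner gap can only be a
      descent.\<close>
    consider "k = m" "\<sigma> k > \<sigma> (Suc k)" | "k \<noteq> m" "\<sigma> k + 2 \<le> \<sigma> (Suc k)"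
      | "k \<noteq> m" "Suc (\<sigma> k) = \<sigma> (Suc k)" | "k \<noteq> m" "\<sigma> k > \<sigma> (Suc k)"
      using ne bd m[of k] by linarith
    then show ?thesis
      using j d l True unfolding g_def Let_def by cases auto
  next
    case False
    then have "k = n" using k by simp
    let ?\<tau> = "\<sigma> \<circ> insert_pos n n"
    have bd: "\<sigma> n \<le> n" using le by auto
    have "jump (Suc n) ?\<tau> = ?a + of_bool (n \<noteq> m)"
      using card_word_append[OF s, of "\<lambda>u v. u + 2 \<le> v"] bd m[of n]
      unfolding jump_eq by (auto simp: of_bool_def)
    moreover have "des (Suc n) ?\<tau> = ?b"
      using card_word_append[OF s, of "\<lambda>u v. u > v"] bd
      unfolding dsuc[OF order.refl] des_eq[OF s] by simp
    moreover have "lsuc (Suc n) ?\<tau> = ?c + of_bool (n = m)"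
      using card_word_append[OF s, of "\<lambda>u v. Suc u = v"] m[of n]
      unfolding lsuc_eq by simp
    ultimately show ?thesis
      using \<open>k = n\<close> by (simp add: g_def Let_def)
  qed
  let ?K = "{..n} - {m}"
  let ?P = "\<lambda>k. k < n \<and> \<sigma> k + 2 \<le> \<sigma> (Suc k)" and ?Q = "\<lambda>k. k < n \<and> Suc (\<sigma> k) = \<sigma> (Suc k)"
  \<comment> \<open>Since \<open>\<sigma> m = n\<close> is maximal, gap \<open>m\<close> is neither
    a jump nor a left succession, so removing \<open>m\<close> leaves both of these counts
    intact.\<close>
  have top: "\<not> Suc n \<le> \<sigma> (Suc m)" if "m < n" using le[of "Suc m"] that by simp
  have P: "{k \<in> ?K. ?P k} = {k \<in> {..<n}. \<sigma> k + 2 \<le> \<sigma> (Suc k)}"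
    using top m[of m] by auto
  have Q: "{k \<in> ?K. ?Q k} = {k \<in> {..<n}. Suc (\<sigma> k) = \<sigma> (Suc k)}"
    using top m[of m] by auto
  have "(\<Sum>k\<le>n. g k) = g m + (\<Sum>k\<in>?K. g k)"
    using \<open>m \<le> n\<close> by (subst sum.remove[of _ m]) auto
  also have "(\<Sum>k\<in>?K. g k) = (\<Sum>k\<in>?K. if ?P k then f ?a (Suc ?b) ?c
      else if ?Q k then f (Suc ?a) (Suc ?b) (?c - 1) else f (Suc ?a) ?b ?c)"
    by (rule sum.cong) (use g in auto)
  \<comment> \<open>As \<open>?K\<close> has \<open>n\<close> elements and the statistics add up to
    \<open>n\<close>, the default class, made of the descents and the end gap without gap
    \<open>m\<close>, has size \<open>?b\<close>.\<close>
  also have "\<dots> = of_nat (card {k \<in> ?K. ?P k}) * f ?a (Suc ?b) ?c + of_nat ?b * f (Suc ?a) ?b ?c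
      + of_nat (card {k \<in> ?K. ?Q k}) * f (Suc ?a) (Suc ?b) (?c - 1)"
    using jump_des_lsuc_sum[OF s] \<open>m \<le> n\<close>
    by (intro sum_if_if_const) (auto simp only: P Q jump_eq[symmetric] lsuc_eq[symmetric]
        finite_Diff finite_atMost card_Diff_singleton atMost_iff card_atMost diff_Suc_1)
  finally show ?thesis
    using g[OF \<open>m \<le> n\<close>]
    by (simp only: P Q jump_eq[symmetric] lsuc_eq[symmetric] g_def[symmetric]
        insertion_step_def add.assoc simp_thms if_True)
qed

lemma sum_permutes_Suc_jump_des_lsuc:
  fixes f :: "nat \<Rightarrow> nat \<Rightarrow> nat \<Rightarrow> 'a::comm_semiring_1"
  shows "(\<Sum>\<sigma> | \<sigma> permutes {1..Suc n}.
      f (jump (Suc n) \<sigma>) (des (Suc n) \<sigma>) (lsuc (Suc n) \<sigma>)) =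
    (\<Sum>\<sigma> | \<sigma> permutes {1..n}. insertion_step f (jump n \<sigma>) (des n \<sigma>) (lsuc n \<sigma>))"
  unfolding sum_permutes_Suc_word
  using sum_word_insertions[of _ n f] by (intro sum.cong) (simp_all only: Let_def mem_Collect_eq)

section \<open>Equidistribution by induction on the common growth rule\<close>

lemma jump_des_lsuc_equidistributed:
  fixes f :: "nat \<Rightarrow> nat \<Rightarrow> nat \<Rightarrow> 'a::comm_semiring_1"
  shows "(\<Sum>\<sigma> | \<sigma> permutes {1..n}. f (jump n \<sigma>) (des n \<sigma>) (lsuc n \<sigma>)) =
    (\<Sum>\<sigma> | \<sigma> permutes {1..n}. f (exc n \<sigma>) (drop_stat n \<sigma>) (fix_stat n \<sigma>))"
\<comment> \<open>The weight must be general: the hypothesis for \<open>n\<close> is applied to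
  \<open>insertion_step f\<close> instead of \<open>f\<close>.\<close>
proof (induction n arbitrary: f)
  case 0
  show ?case
    by (simp add: jump_def des_def lsuc_def exc_def drop_stat_def fix_stat_def)
next
  case (Suc n)
  show ?case
    unfolding sum_permutes_Suc_jump_des_lsuc sum_permutes_Suc_exc_drop_fix by (rule Suc.IH)
qed

theorem theorem3p5:
  fixes n :: nat and x y z :: "'a :: comm_semiring_1"
  assumes "n \<ge> 1"
  shows "(\<Sum>\<sigma> | \<sigma> permutes {1..n}. x ^ jump n \<sigma> * y ^ des n \<sigma> * z ^ lsuc n \<sigma>) =
         (\<Sum>\<sigma> | \<sigma> permutes {1..n}. x ^ exc n \<sigma> * y ^ drop_stat n \<sigma> * z ^ fix_stat n \<sigma>)"
  by (rule jump_des_lsuc_equidistributed[where f = "\<lambda>a b c. x ^ a * y ^ b * z ^ c"])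

end
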